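(* Let $A\in\mathbb{R}_+^{n\times n}$ be irreducible and let $b\in\mathbb{R}_+^n$ be such that $\operatorname{rank}([b\ Ab\ \dots\ A^{n-1}b])=n$. The finite controllable subset $\mathrm{Conset}_{\mathrm f}(A,b)$ is polyhedral if and only if there exists a positive integer $k^*$ such that $$\mathrm{Conset}_{k^*+1}(A,b)\subseteq\mathrm{Conset}_{k^*}(A,b),$$ or, equivalently, such that $A^{k^*}b\in\mathrm{Conset}_{k^*}(A,b)$.
   Context: $\mathbb{R}_+=[0,\infty)$. A cone is polyhedral if it is the set of all nonnegative linear combinations of finitely many vectors. A matrix $A\in\mathbb{R}_+^{n\times n}$ is reducible if for some permutation matrix $P$, $P^TAP=\begin{bmatrix} A_{11} & 0 \\ A_{21} & A_{22} \end{bmatrix}$ with square nonempty diagonal blocks; otherwise it is irreducible (a $1\times1$ matrix is regarded as irreducible exactly when its entry is strictly positive). For the system $x(t+1)=Ax(t)+bu(t)$, $x(0)=0$, with scalar inputs $u(t)\ge0$: $\mathrm{Conset}_k(A,b)=\{\sum_{i=1}^{k}A^{i-1}b\,u(k-i):u(0),\dots,u(k-1)\ge0\}$ for integers $k\ge1$, and $\mathrm{Conset}_{\mathrm f}(A,b)=\bigcup_{k\ge1}\mathrm{Conset}_k(A,b)$. *)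

theory Defs
  imports "Jordan_Normal_Form.DL_Rank" "HOL-Combinatorics.Permutations"
begin

definition permutation_mat :: "nat \<Rightarrow> real mat \<Rightarrow> bool" where
  "permutation_mat n P \<longleftrightarrow>
     (\<exists>p. p permutes {..<n} \<and> P = mat n n (\<lambda>(i, j). if i = p j then 1 else 0))"

definition reducible_mat :: "nat \<Rightarrow> real mat \<Rightarrow> bool" where
  "reducible_mat n A \<longleftrightarrow>
     (\<exists>P r A11 A21 A22. permutation_mat n P \<and> 0 < r \<and> r < n \<and>
        A11 \<in> carrier_mat r r \<and> A21 \<in> carrier_mat (n - r) r \<and> A22 \<in> carrier_mat (n - r) (n - r) \<and>
        transpose_mat P * A * P = four_block_mat A11 (0\<^sub>m r (n - r)) A21 A22)"

(* No 1 x 1 matrix is reducible, so the convention for n = 1 is a separate case. *)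
definition irreducible_mat :: "nat \<Rightarrow> real mat \<Rightarrow> bool" where
  "irreducible_mat n A \<longleftrightarrow> (if n = 1 then 0 < A $$ (0, 0) else \<not> reducible_mat n A)"

definition conset :: "nat \<Rightarrow> real mat \<Rightarrow> real vec \<Rightarrow> nat \<Rightarrow> real vec set" where
  "conset n A b k =
     {finsum_vec TYPE(real) n (\<lambda>i. u (k - i) \<cdot>\<^sub>v ((A ^\<^sub>m (i - 1)) *\<^sub>v b)) {1..k} |
        u :: nat \<Rightarrow> real. \<forall>t<k. 0 \<le> u t}"

definition conset_fin :: "nat \<Rightarrow> real mat \<Rightarrow> real vec \<Rightarrow> real vec set" where
  "conset_fin n A b = (\<Union>k\<in>{1..}. conset n A b k)"

definition polyhedral_cone :: "nat \<Rightarrow> real vec set \<Rightarrow> bool" where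
  "polyhedral_cone n C \<longleftrightarrow>
     (\<exists>V. finite V \<and> V \<subseteq> carrier_vec n \<and>
        C = {finsum_vec TYPE(real) n (\<lambda>v. c v \<cdot>\<^sub>v v) V | c :: real vec \<Rightarrow> real. \<forall>v\<in>V. 0 \<le> c v})"

definition controllability_mat :: "nat \<Rightarrow> real mat \<Rightarrow> real vec \<Rightarrow> real mat" where
  "controllability_mat n A b = mat_of_cols n (map (\<lambda>i. (A ^\<^sub>m i) *\<^sub>v b) [0..<n])"

end

theory Submission
  imports Defs
begin

text \<open>The sets \<open>conset n A b k\<close> are the cones generated by \<open>b, A b, \<dots>, A\<^sup>k\<^sup>-\<^sup>1 b\<close>, and they
  increase with \<open>k\<close>. If their union is polyhedral, all of its finitely many generators lie in a
  single one of them, which is then the whole union and contains \<open>A\<^sup>k b\<close>. Conversely, if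
  \<open>A\<^sup>k b\<close> lies in the \<open>k\<close>-th cone, then that cone is invariant under \<open>A\<close>, so it contains every
  \<open>A\<^sup>m b\<close> and equals the union.\<close>

text \<open>Generators are indexed by a family, because the vectors \<open>A\<^sup>i b\<close> need not be distinct.\<close>

definition family_cone :: "nat \<Rightarrow> ('i \<Rightarrow> real vec) \<Rightarrow> 'i set \<Rightarrow> real vec set" where
  "family_cone n w I =
     {finsum_vec TYPE(real) n (\<lambda>i. c i \<cdot>\<^sub>v w i) I | c. \<forall>i\<in>I. 0 \<le> c i}"

text \<open>Turns membership into real sums, one per coordinate, so that later arguments can use the
  sum lemmas instead of \<open>finsum_vec\<close>. The carrier condition fixes the dimension, which
  the coordinates below \<open>n\<close> alone do not determine.\<close>

lemma mem_family_cone_iff: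
  assumes "finite I" "w ` I \<subseteq> carrier_vec n"
  shows "x \<in> family_cone n w I \<longleftrightarrow>
    x \<in> carrier_vec n \<and>
    (\<exists>c. (\<forall>i\<in>I. 0 \<le> c i) \<and> (\<forall>j<n. x $ j = (\<Sum>i\<in>I. c i * w i $ j)))"
proof -
  have wI: "w i \<in> carrier_vec n" if "i \<in> I" for i
    using assms that by auto
  have clo: "finsum_vec TYPE(real) n (\<lambda>i. c i \<cdot>\<^sub>v w i) I \<in> carrier_vec n" for c
    by (rule finsum_vec_closed) (use wI in auto)
  have idx: "finsum_vec TYPE(real) n (\<lambda>i. c i \<cdot>\<^sub>v w i) I $ j = (\<Sum>i\<in>I. c i * w i $ j)"
    if "j < n" for c j
  proof -
    have "finsum_vec TYPE(real) n (\<lambda>i. c i \<cdot>\<^sub>v w i) I $ j = (\<Sum>i\<in>I. (c i \<cdot>\<^sub>v w i) $ j)"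
      by (rule index_finsum_vec) (use assms wI that in auto)
    also have "\<dots> = (\<Sum>i\<in>I. c i * w i $ j)"
      by (intro sum.cong refl) (use wI that in fastforce)
    finally show ?thesis .
  qed
  have eq: "x = finsum_vec TYPE(real) n (\<lambda>i. c i \<cdot>\<^sub>v w i) I \<longleftrightarrow>
      x \<in> carrier_vec n \<and> (\<forall>j<n. x $ j = (\<Sum>i\<in>I. c i * w i $ j))" for c
    using clo[of c] idx[of _ c] by (auto intro!: eq_vecI)
  show ?thesis
    unfolding family_cone_def mem_Collect_eq eq by blast
qed

lemma generator_in_family_cone:
  assumes "finite I" "w ` I \<subseteq> carrier_vec n" "i \<in> I"
  shows "w i \<in> family_cone n w I"
proof -
  \<comment> \<open>The witness is the indicator of the index \<open>i\<close>, not of the vector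
    \<open>w i\<close>, so repetitions in the family do no harm.\<close>
  have "(\<Sum>i'\<in>I. (if i' = i then 1 else 0) * w i' $ j) = w i $ j" for j
    using assms by (simp add: if_distrib[of "\<lambda>c. c * _"] sum.delta cong: if_cong)
  then show ?thesis
    using assms by (subst mem_family_cone_iff) (auto intro!: exI[of _ "\<lambda>i'. if i' = i then 1 else 0"])
qed

text \<open>Substituting one nonnegative combination into another gives coefficients
  \<open>\<Sum>i\<in>I. c i * d i l\<close>, which are again nonnegative. The lemma reduces
  inclusions between cones to a check on generators.\<close>

lemma family_cone_least:
  assumes I: "finite I" "w ` I \<subseteq> carrier_vec n"
    and J: "finite J" "w' ` J \<subseteq> carrier_vec n"
    and sub: "w ` I \<subseteq> family_cone n w' J"
  shows "family_cone n w I \<subseteq> family_cone n w' J"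
proof
  fix x assume "x \<in> family_cone n w I"
  then obtain c where x: "x \<in> carrier_vec n" and c: "\<forall>i\<in>I. 0 \<le> c i"
    and xc: "\<forall>j<n. x $ j = (\<Sum>i\<in>I. c i * w i $ j)"
    unfolding mem_family_cone_iff[OF I] by blast
  have "\<forall>i\<in>I. \<exists>d. (\<forall>l\<in>J. 0 \<le> d l) \<and> (\<forall>j<n. w i $ j = (\<Sum>l\<in>J. d l * w' l $ j))"
    using sub mem_family_cone_iff[OF J] by blast
  then obtain d where d: "\<forall>i\<in>I. \<forall>l\<in>J. 0 \<le> d i l"
    and wd: "\<forall>i\<in>I. \<forall>j<n. w i $ j = (\<Sum>l\<in>J. d i l * w' l $ j)"
    by metis
  have "x $ j = (\<Sum>l\<in>J. (\<Sum>i\<in>I. c i * d i l) * w' l $ j)" if "j < n" for j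
  proof -
    have "x $ j = (\<Sum>i\<in>I. \<Sum>l\<in>J. c i * d i l * w' l $ j)"
      using xc wd that by (simp add: sum_distrib_left mult.assoc)
    also have "\<dots> = (\<Sum>l\<in>J. (\<Sum>i\<in>I. c i * d i l) * w' l $ j)"
      by (subst sum.swap) (simp add: sum_distrib_right)
    finally show ?thesis .
  qed
  moreover have "\<forall>l\<in>J. 0 \<le> (\<Sum>i\<in>I. c i * d i l)"
    using c d by (auto intro!: sum_nonneg)
  ultimately show "x \<in> family_cone n w' J"
    using x unfolding mem_family_cone_iff[OF J] by (auto intro!: exI[of _ "\<lambda>l. \<Sum>i\<in>I. c i * d i l"])
qed

lemma family_cone_mono:
  assumes "finite J" "w ` J \<subseteq> carrier_vec n" "I \<subseteq> J"
  shows "family_cone n w I \<subseteq> family_cone n w J"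
  using assms by (intro family_cone_least) (auto intro: generator_in_family_cone finite_subset)

text \<open>Passes from a family with possible repetitions to the set of generators that
  \<open>polyhedral_cone\<close> asks for. Comparing generators in both directions avoids adding up
  the coefficients of equal vectors.\<close>

lemma family_cone_image:
  assumes "finite I" "w ` I \<subseteq> carrier_vec n"
  shows "family_cone n (\<lambda>v. v) (w ` I) = family_cone n w I"
proof
  show "family_cone n (\<lambda>v. v) (w ` I) \<subseteq> family_cone n w I"
    using assms by (intro family_cone_least) (auto intro: generator_in_family_cone)
  have "w i \<in> family_cone n (\<lambda>v. v) (w ` I)" if "i \<in> I" for i
    using assms that generator_in_family_cone[of "w ` I" "\<lambda>v. v" n "w i"] by auto
  then show "family_cone n w I \<subseteq> family_cone n (\<lambda>v. v) (w ` I)"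
    using assms by (intro family_cone_least) auto
qed

text \<open>By linearity the coefficients of \<open>x\<close> also serve for its image.\<close>

lemma mult_mat_vec_family_cone:
  assumes A: "A \<in> carrier_mat n n" and I: "finite I" "w ` I \<subseteq> carrier_vec n"
    and x: "x \<in> family_cone n w I"
  shows "A *\<^sub>v x \<in> family_cone n (\<lambda>i. A *\<^sub>v w i) I"
proof -
  obtain c where xn: "x \<in> carrier_vec n" and c: "\<forall>i\<in>I. 0 \<le> c i"
    and xc: "\<forall>j<n. x $ j = (\<Sum>i\<in>I. c i * w i $ j)"
    using x unfolding mem_family_cone_iff[OF I] by blast
  have AI: "(\<lambda>i. A *\<^sub>v w i) ` I \<subseteq> carrier_vec n"
    using A I by auto
  have mv: "(A *\<^sub>v v) $ j = (\<Sum>l = 0..<n. A $$ (j, l) * v $ l)"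
    if "j < n" "v \<in> carrier_vec n" for j v
    using A that by (auto simp: scalar_prod_def)
  have "(A *\<^sub>v x) $ j = (\<Sum>i\<in>I. c i * (A *\<^sub>v w i) $ j)" if "j < n" for j
  proof -
    have "(A *\<^sub>v x) $ j = (\<Sum>l = 0..<n. \<Sum>i\<in>I. c i * (A $$ (j, l) * w i $ l))"
      using mv[OF that xn] xc by (simp add: sum_distrib_left mult.left_commute)
    also have "\<dots> = (\<Sum>i\<in>I. c i * (\<Sum>l = 0..<n. A $$ (j, l) * w i $ l))"
      by (subst sum.swap) (simp add: sum_distrib_left)
    also have "\<dots> = (\<Sum>i\<in>I. c i * (A *\<^sub>v w i) $ j)"
      using I mv[OF that] by (intro sum.cong refl) (auto simp: image_subset_iff)
    finally show ?thesis .
  qed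
  then show ?thesis
    unfolding mem_family_cone_iff[OF I(1) AI] using A xn c by auto
qed

lemma polyhedral_cone_iff:
  "polyhedral_cone n C \<longleftrightarrow>
    (\<exists>V. finite V \<and> V \<subseteq> carrier_vec n \<and> C = family_cone n (\<lambda>v. v) V)"
  unfolding polyhedral_cone_def family_cone_def ..

text \<open>\<open>pow_mat\<close> appends the new factor on the right, whereas the main proof
  applies \<open>A\<close> from the left. The induction generalises \<open>b\<close> because its
  hypothesis is used at \<open>A *\<^sub>v b\<close>.\<close>

lemma pow_mat_mult_vec_Suc:
  assumes A: "A \<in> carrier_mat n n" and b: "b \<in> carrier_vec n"
  shows "(A ^\<^sub>m Suc k) *\<^sub>v b = A *\<^sub>v ((A ^\<^sub>m k) *\<^sub>v b)"
  using b
proof (induction k arbitrary: b)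
  case 0
  then show ?case using A by simp
next
  case (Suc k)
  have "(A ^\<^sub>m Suc (Suc k)) *\<^sub>v b = (A ^\<^sub>m Suc k) *\<^sub>v (A *\<^sub>v b)"
    using A Suc.prems pow_carrier_mat[OF A, of "Suc k"]
    by (subst pow_mat.simps(2)) (rule assoc_mult_mat_vec)
  also have "\<dots> = A *\<^sub>v ((A ^\<^sub>m k) *\<^sub>v (A *\<^sub>v b))"
    using A Suc by (metis mult_mat_vec_carrier)
  also have "(A ^\<^sub>m k) *\<^sub>v (A *\<^sub>v b) = (A ^\<^sub>m Suc k) *\<^sub>v b"
    using A Suc.prems pow_carrier_mat[OF A, of k]
    by (subst pow_mat.simps(2)) (rule assoc_mult_mat_vec[symmetric])
  finally show ?case .
qed

text \<open>The input sequence, read backwards in time, is the coefficient sequence: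
  \<open>A ^\<^sub>m i\<close> applied to \<open>b\<close> has weight \<open>u (k - Suc i)\<close>.
  The exponents are also shifted to start at 0.\<close>

lemma conset_eq_family_cone:
  assumes A: "A \<in> carrier_mat n n" and b: "b \<in> carrier_vec n"
  shows "conset n A b k = family_cone n (\<lambda>i. (A ^\<^sub>m i) *\<^sub>v b) {..<k}"
proof -
  let ?w = "\<lambda>i. (A ^\<^sub>m i) *\<^sub>v b"
  have w: "?w i \<in> carrier_vec n" for i
    using pow_carrier_mat[OF A] b by (rule mult_mat_vec_carrier)
  have sum_eq: "finsum_vec TYPE(real) n (\<lambda>i. u (k - i) \<cdot>\<^sub>v ?w (i - 1)) {1..k} =
      finsum_vec TYPE(real) n (\<lambda>i. u (k - Suc i) \<cdot>\<^sub>v ?w i) {..<k}" (is "?L = ?R") for u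
  proof (rule eq_vecI)
    have L: "?L \<in> carrier_vec n" and R: "?R \<in> carrier_vec n"
      by (rule finsum_vec_closed; use w in auto)+
    then show "dim_vec ?L = dim_vec ?R" by simp
    fix j assume "j < dim_vec ?R"
    then have j: "j < n" using R by simp
    have "?L $ j = (\<Sum>i\<in>{1..k}. (u (k - i) \<cdot>\<^sub>v ?w (i - 1)) $ j)"
      by (rule index_finsum_vec) (use w j in auto)
    also have "\<dots> = (\<Sum>i\<in>{..<k}. (u (k - Suc i) \<cdot>\<^sub>v ?w i) $ j)"
      by (rule sum.reindex_bij_witness[of _ Suc "\<lambda>i. i - 1"]) auto
    also have "\<dots> = ?R $ j"
      by (rule index_finsum_vec[symmetric]) (use w j in auto)
    finally show "?L $ j = ?R $ j" .
  qed
  show ?thesis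
  proof (intro subset_antisym subsetI)
    fix x assume "x \<in> conset n A b k"
    then obtain u where "\<forall>t<k. 0 \<le> u t"
      and "x = finsum_vec TYPE(real) n (\<lambda>i. u (k - Suc i) \<cdot>\<^sub>v ?w i) {..<k}"
      unfolding conset_def sum_eq by blast
    then show "x \<in> family_cone n ?w {..<k}"
      unfolding family_cone_def by (auto intro!: exI[of _ "\<lambda>i. u (k - Suc i)"])
  next
    fix x assume "x \<in> family_cone n ?w {..<k}"
    then obtain c where c: "\<forall>i<k. 0 \<le> c i"
      and x: "x = finsum_vec TYPE(real) n (\<lambda>i. c i \<cdot>\<^sub>v ?w i) {..<k}"
      unfolding family_cone_def by auto
    \<comment> \<open>Reversing time twice gives back \<open>i\<close> only for
      \<open>i < k\<close>, so the summands are compared on the index set alone.\<close>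
    have "x = finsum_vec TYPE(real) n (\<lambda>i. c (k - Suc (k - Suc i)) \<cdot>\<^sub>v ?w i) {..<k}"
      unfolding x finsum_vec_def
      by (rule comm_monoid.finprod_cong'[OF comm_monoid_vec]) (use w in \<open>auto simp: monoid_vec_simps\<close>)
    then show "x \<in> conset n A b k"
      unfolding conset_def sum_eq using c
      by (auto intro!: exI[of _ "\<lambda>t. c (k - Suc t)"])
  qed
qed

theorem proposition3:
  fixes n :: nat and A :: "real mat" and b :: "real vec"
  assumes "1 \<le> n"
    and "A \<in> carrier_mat n n" and "\<forall>i<n. \<forall>j<n. 0 \<le> A $$ (i, j)"
    and "irreducible_mat n A"
    and "b \<in> carrier_vec n" and "\<forall>i<n. 0 \<le> b $ i"
    and "vec_space.rank n (controllability_mat n A b) = n"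
  shows "(polyhedral_cone n (conset_fin n A b) \<longleftrightarrow>
            (\<exists>k\<ge>1. conset n A b (k + 1) \<subseteq> conset n A b k)) \<and>
         (polyhedral_cone n (conset_fin n A b) \<longleftrightarrow>
            (\<exists>k\<ge>1. (A ^\<^sub>m k) *\<^sub>v b \<in> conset n A b k)) \<and>
         (\<forall>k\<ge>1. conset n A b (k + 1) \<subseteq> conset n A b k \<longleftrightarrow>
            (A ^\<^sub>m k) *\<^sub>v b \<in> conset n A b k)"
proof -
  note A = assms(2) and b = assms(5)
  define w where "w i = (A ^\<^sub>m i) *\<^sub>v b" for i
  have w: "w ` I \<subseteq> carrier_vec n" for I
    using pow_carrier_mat[OF A] b by (auto simp: w_def intro: mult_mat_vec_carrier)
  have w_Suc: "A *\<^sub>v w i = w (Suc i)" for i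
    using pow_mat_mult_vec_Suc[OF A b, of i] by (simp add: w_def)
  have cs: "conset n A b k = family_cone n w {..<k}" for k
    using conset_eq_family_cone[OF A b, of k] by (simp add: w_def[abs_def])
  have mono: "conset n A b k \<subseteq> conset n A b l" if "k \<le> l" for k l
    unfolding cs using w that by (intro family_cone_mono) auto
  have gen: "w i \<in> conset n A b k" if "i < k" for i k
    unfolding cs using w that by (intro generator_in_family_cone) auto
  have sub_iff: "conset n A b (k + 1) \<subseteq> conset n A b k \<longleftrightarrow> w k \<in> conset n A b k" for k
  proof
    assume "w k \<in> conset n A b k"
    \<comment> \<open>The larger cone has just one additional generator, \<open>w k\<close>.\<close>
    then have "w ` {..<k + 1} \<subseteq> conset n A b k"
      using gen by (auto simp: less_Suc_eq)
    then show "conset n A b (k + 1) \<subseteq> conset n A b k"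
      unfolding cs using w by (intro family_cone_least) auto
  qed (use gen[of k "k + 1"] in auto)
  have poly_iff: "polyhedral_cone n (conset_fin n A b) \<longleftrightarrow> (\<exists>k\<ge>1. w k \<in> conset n A b k)"
  proof
    assume "polyhedral_cone n (conset_fin n A b)"
    then obtain V where V: "finite V" "V \<subseteq> carrier_vec n"
      and C: "conset_fin n A b = family_cone n (\<lambda>v. v) V"
      unfolding polyhedral_cone_iff by blast
    have "v \<in> conset_fin n A b" if "v \<in> V" for v
      unfolding C using V that generator_in_family_cone[of V "\<lambda>v. v" n v] by simp
    then have "\<forall>v\<in>V. \<exists>k. v \<in> conset n A b k"
      unfolding conset_fin_def by blast
    then obtain f where f: "\<forall>v\<in>V. v \<in> conset n A b (f v)"
      by metis
    \<comment> \<open>The sum bounds every \<open>f v\<close> and makes sense for empty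
      \<open>V\<close> too; \<open>Suc\<close> ensures that \<open>k\<close> is positive.\<close>
    define k where "k = Suc (\<Sum>v\<in>V. f v)"
    have "V \<subseteq> conset n A b k"
    proof
      fix v assume "v \<in> V"
      then have "f v \<le> k"
        using V member_le_sum[of v V f] by (simp add: k_def)
      then show "v \<in> conset n A b k"
        using mono f \<open>v \<in> V\<close> by blast
    qed
    then have "conset_fin n A b \<subseteq> conset n A b k"
      unfolding C cs using V w by (intro family_cone_least) auto
    moreover have "w k \<in> conset_fin n A b"
      unfolding conset_fin_def using gen[of k "Suc k"] by auto
    ultimately show "\<exists>k\<ge>1. w k \<in> conset n A b k"
      by (auto simp: k_def)
  next
    assume "\<exists>k\<ge>1. w k \<in> conset n A b k"
    then obtain k where k: "k \<ge> 1" "w k \<in> conset n A b k" by blast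
    \<comment> \<open>Shifting turns each generator into the next one, except that the last becomes
      \<open>w k\<close>, which is in the cone by assumption.\<close>
    have shift: "family_cone n (\<lambda>i. w (Suc i)) {..<k} \<subseteq> conset n A b k"
      unfolding cs
    proof (rule family_cone_least)
      show "(\<lambda>i. w (Suc i)) ` {..<k} \<subseteq> family_cone n w {..<k}"
        unfolding cs[symmetric] using gen k(2) by (auto simp: Suc_le_eq le_less dest!: Suc_leI)
    qed (use w in auto)
    \<comment> \<open>By \<open>shift\<close> the cone is invariant under \<open>A\<close>, so it
      contains the whole orbit of \<open>b\<close> once it contains \<open>w 0\<close>; the latter
      uses \<open>k \<ge> 1\<close>.\<close>
    have w_in: "w m \<in> conset n A b k" for m
    proof (induction m)
      case 0
      show ?case using gen k(1) by simp
    next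
      case (Suc m)
      then have "A *\<^sub>v w m \<in> family_cone n (\<lambda>i. A *\<^sub>v w i) {..<k}"
        unfolding cs using A w by (intro mult_mat_vec_family_cone) auto
      then show ?case
        using shift by (auto simp: w_Suc)
    qed
    have "conset n A b l \<subseteq> conset n A b k" for l
      unfolding cs using w w_in by (intro family_cone_least) (auto simp: cs[symmetric])
    \<comment> \<open>Since \<open>k \<ge> 1\<close>, this cone is itself a member of the union,
      which gives the reverse inclusion.\<close>
    then have "conset_fin n A b = conset n A b k"
      unfolding conset_fin_def using k(1) by blast
    also have "\<dots> = family_cone n (\<lambda>v. v) (w ` {..<k})"
      unfolding cs using w by (intro family_cone_image[symmetric]) auto
    finally show "polyhedral_cone n (conset_fin n A b)"
      unfolding polyhedral_cone_iff using w by blast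
  qed
  show ?thesis
    using sub_iff poly_iff by (simp add: w_def)
qed

end
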